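(* Let $\alpha,\beta,\gamma,\varepsilon$ be real constants such that the operator $$ M= \begin{pmatrix} \varepsilon(1-\partial^2) & \alpha-\beta\partial \\ \alpha+\beta\partial & \gamma \end{pmatrix} $$ is strictly positive and invertible. For $\begin{pmatrix} m\\ p\end{pmatrix}\in\mathfrak g^*_{reg}$ put $\begin{pmatrix} u\\ v\end{pmatrix}=M^{-1}\begin{pmatrix} m\\ p\end{pmatrix}$, so that $m=\varepsilon u-\varepsilon u_{xx}+\alpha v-\beta v_x$ and $p=\alpha u+\beta u_x+\gamma v$, and let $$ H_0\begin{pmatrix} m\\ p\end{pmatrix}=\frac12\left\langle \begin{pmatrix} m\\ p\end{pmatrix},M^{-1}\begin{pmatrix} m\\ p\end{pmatrix}\right\rangle, $$ $$ H_1\begin{pmatrix} m\\ p\end{pmatrix}=\frac{1}{2}\int_{S^1}\left(2\alpha u^2v+2\beta uu_xv+\gamma uv^2+\varepsilon u^3+\varepsilon uu_x^2\right)dx, $$ $$ J_1= \begin{pmatrix} \varepsilon(\partial-\partial^3) & \alpha\partial-\beta\partial^2 \\ \alpha\partial+\beta\partial^2 & \gamma\partial \end{pmatrix}. $$ Then the vector field $X=J_0\,\delta H_0$ on $\mathfrak g^*_{reg}$ satisfies $$X=J_0\,\delta H_0=J_1\,\delta H_1,$$ and the corresponding evolution equation $\begin{pmatrix} m\\ p\end{pmatrix}_t+X=0$ is the system $$ \begin{cases} m_t+m_xu+2mu_x+pv_x=0,\\ p_t+(pu)_x=0. \end{cases} $$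
   Context: $S^1$ is the circle with coordinate $x$ (of period $2\pi$) and $\partial=\frac{d}{dx}$. $\mathfrak g=\mathrm{Vect}(S^1)\ltimes C^\infty(S^1)$, where $f\in \mathrm{Vect}(S^1)$ acts on $C^\infty(S^1)$ by $L_f a=f a'$. The regular part $\mathfrak g^*_{reg}$ of the dual space is the set of pairs $\begin{pmatrix} m\\ p\end{pmatrix}$ with $m,p\in C^\infty(S^1)$, acting on $\mathfrak g$ through the $L^2$ pairing $$\left\langle \begin{pmatrix} m_1\\ p_1\end{pmatrix},\begin{pmatrix} m_2\\ p_2\end{pmatrix}\right\rangle=\int_{S^1}(m_1m_2+p_1p_2)\,dx.$$ For a smooth functional $H$ on $\mathfrak g^*_{reg}$, $\delta H$ denotes its gradient with respect to this $L^2$ pairing. The canonical Lie-Poisson structure on $\mathfrak g^*_{reg}$ is given by the skew-symmetric operator, depending on the point $\begin{pmatrix} m\\ p\end{pmatrix}$, $$J_0\left(\begin{pmatrix} m\\ p\end{pmatrix}\right)=\begin{pmatrix} m_x+2m\partial & p\partial\\ p_x+p\partial & 0\end{pmatrix},$$ where functions act by multiplication. The operator $M$ acts on pairs of smooth functions on $S^1$ and is symmetric with respect to $\langle\cdot,\cdot\rangle$. Strictly positive means $\langle w,Mw\rangle>0$ for all nonzero $w$. *)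

theory Defs
  imports "HOL-Analysis.Analysis"
begin

(* Functions on the circle are 2 pi-periodic functions of a real variable. *)

definition smooth_S1 :: "(real \<Rightarrow> real) set" where
  "smooth_S1 = {f. (\<forall>n x. (deriv ^^ n) f differentiable (at x)) \<and> (\<forall>x. f (x + 2 * pi) = f x)}"

type_synonym fpair = "(real \<Rightarrow> real) \<times> (real \<Rightarrow> real)"

(* The regular dual; pairs in the Lie algebra itself have the same carrier. *)
definition g_reg :: "fpair set" where
  "g_reg = smooth_S1 \<times> smooth_S1"

definition pairing :: "fpair \<Rightarrow> fpair \<Rightarrow> real" where
  "pairing w z = integral {0..2 * pi} (\<lambda>x. fst w x * fst z x + snd w x * snd z x)"

(* The gradient represents all directional derivatives at w along g_reg. *)
definition has_gradient :: "(fpair \<Rightarrow> real) \<Rightarrow> fpair \<Rightarrow> fpair \<Rightarrow> bool" where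
  "has_gradient H w g \<longleftrightarrow> g \<in> g_reg \<and>
     (\<forall>h\<in>g_reg. ((\<lambda>s. H (\<lambda>x. fst w x + s * fst h x, \<lambda>x. snd w x + s * snd h x))
        has_real_derivative pairing g h) (at 0))"

definition grad :: "(fpair \<Rightarrow> real) \<Rightarrow> fpair \<Rightarrow> fpair" where
  "grad H w = (THE g. has_gradient H w g)"

fun J0 :: "fpair \<Rightarrow> fpair \<Rightarrow> fpair" where
  "J0 (m, p) (f, g) =
     (\<lambda>x. (deriv m x * f x + 2 * m x * deriv f x) + p x * deriv g x,
      \<lambda>x. deriv p x * f x + p x * deriv f x)"

definition strictly_positive :: "(fpair \<Rightarrow> fpair) \<Rightarrow> bool" where
  "strictly_positive A \<longleftrightarrow> (\<forall>w\<in>g_reg. w \<noteq> (\<lambda>_. 0, \<lambda>_. 0) \<longrightarrow> pairing w (A w) > 0)"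

definition invertible_op :: "(fpair \<Rightarrow> fpair) \<Rightarrow> bool" where
  "invertible_op A \<longleftrightarrow> bij_betw A g_reg g_reg"

fun M :: "real \<Rightarrow> real \<Rightarrow> real \<Rightarrow> real \<Rightarrow> fpair \<Rightarrow> fpair" where
  "M \<alpha> \<beta> \<gamma> \<epsilon> (u, v) =
     (\<lambda>x. \<epsilon> * (u x - (deriv ^^ 2) u x) + (\<alpha> * v x - \<beta> * deriv v x),
      \<lambda>x. (\<alpha> * u x + \<beta> * deriv u x) + \<gamma> * v x)"

definition M_inv :: "real \<Rightarrow> real \<Rightarrow> real \<Rightarrow> real \<Rightarrow> fpair \<Rightarrow> fpair" where
  "M_inv \<alpha> \<beta> \<gamma> \<epsilon> = inv_into g_reg (M \<alpha> \<beta> \<gamma> \<epsilon>)"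

fun J1 :: "real \<Rightarrow> real \<Rightarrow> real \<Rightarrow> real \<Rightarrow> fpair \<Rightarrow> fpair" where
  "J1 \<alpha> \<beta> \<gamma> \<epsilon> (f, g) =
     (\<lambda>x. \<epsilon> * (deriv f x - (deriv ^^ 3) f x) + (\<alpha> * deriv g x - \<beta> * (deriv ^^ 2) g x),
      \<lambda>x. (\<alpha> * deriv f x + \<beta> * (deriv ^^ 2) f x) + \<gamma> * deriv g x)"

definition H0 :: "real \<Rightarrow> real \<Rightarrow> real \<Rightarrow> real \<Rightarrow> fpair \<Rightarrow> real" where
  "H0 \<alpha> \<beta> \<gamma> \<epsilon> w = 1 / 2 * pairing w (M_inv \<alpha> \<beta> \<gamma> \<epsilon> w)"

definition H1 :: "real \<Rightarrow> real \<Rightarrow> real \<Rightarrow> real \<Rightarrow> fpair \<Rightarrow> real" where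
  "H1 \<alpha> \<beta> \<gamma> \<epsilon> w = (case M_inv \<alpha> \<beta> \<gamma> \<epsilon> w of (u, v) \<Rightarrow>
     1 / 2 * integral {0..2 * pi} (\<lambda>x.
       2 * \<alpha> * (u x)^2 * v x + 2 * \<beta> * u x * deriv u x * v x + \<gamma> * u x * (v x)^2
       + \<epsilon> * (u x)^3 + \<epsilon> * u x * (deriv u x)^2))"

definition X :: "real \<Rightarrow> real \<Rightarrow> real \<Rightarrow> real \<Rightarrow> fpair \<Rightarrow> fpair" where
  "X \<alpha> \<beta> \<gamma> \<epsilon> w = J0 w (grad (H0 \<alpha> \<beta> \<gamma> \<epsilon>) w)"

(* A curve t \<mapsto> (m t, p t) in g_reg over the time set T, differentiable in t at every x. *)
definition reg_curve :: "real set \<Rightarrow> (real \<Rightarrow> real \<Rightarrow> real) \<Rightarrow> (real \<Rightarrow> real \<Rightarrow> real) \<Rightarrow> bool" where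
  "reg_curve T m p \<longleftrightarrow> (\<forall>t\<in>T. (m t, p t) \<in> g_reg \<and>
     (\<forall>x. (\<lambda>s. m s x) differentiable (at t) \<and> (\<lambda>s. p s x) differentiable (at t)))"

(* (m, p)_t + Y (m, p) = 0 for all times in T *)
definition evolution_eq ::
  "(fpair \<Rightarrow> fpair) \<Rightarrow> real set \<Rightarrow> (real \<Rightarrow> real \<Rightarrow> real) \<Rightarrow> (real \<Rightarrow> real \<Rightarrow> real) \<Rightarrow> bool" where
  "evolution_eq Y T m p \<longleftrightarrow> (\<forall>t\<in>T. \<forall>x.
     deriv (\<lambda>s. m s x) t + fst (Y (m t, p t)) x = 0 \<and>
     deriv (\<lambda>s. p s x) t + snd (Y (m t, p t)) x = 0)"

end

theory Submission
  imports Defs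
begin

text \<open>
  Put \<open>(u, v) = M\<^sup>-\<^sup>1 w\<close>. Since \<open>M\<close> is symmetric for the \<open>L\<^sup>2\<close> pairing, so is \<open>M\<^sup>-\<^sup>1\<close>, and the
  quadratic functional \<open>H\<^sub>0\<close> has gradient \<open>(u, v)\<close>. Hence \<open>J\<^sub>0 \<delta>H\<^sub>0\<close> is obtained by inserting
  \<open>(u, v)\<close> into \<open>J\<^sub>0\<close>, and these are the terms of the evolution system.

  The functional \<open>H\<^sub>1\<close> is a cubic functional \<open>F\<close> of \<open>(u, v)\<close>. By the chain rule and the symmetry
  of \<open>M\<^sup>-\<^sup>1\<close>, \<open>\<delta>H\<^sub>1 = M\<^sup>-\<^sup>1 \<delta>F\<close>. The operator \<open>M\<close> has constant coefficients, so it commutes with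
  \<open>\<partial>\<close>, and \<open>J\<^sub>1\<close> is just \<open>\<partial> \<circ> M\<close>. Therefore \<open>J\<^sub>1 \<delta>H\<^sub>1 = \<partial> M M\<^sup>-\<^sup>1 \<delta>F = \<partial> \<delta>F\<close>: no explicit
  formula for \<open>M\<^sup>-\<^sup>1\<close> is needed. What remains is the pointwise identity
  \<open>\<partial> \<delta>F = J\<^sub>0(m, p) (u, v)\<close> with \<open>(m, p) = M (u, v)\<close>, a polynomial identity in the derivatives
  of \<open>u\<close> and \<open>v\<close> (lemma \<open>J0_M_eq_derivative\<close>).

  Both functionals restricted to an affine line are integrals of polynomials in the line parameter,
  so their directional derivatives are read off from the linear coefficient; integration by
  parts then amounts to exhibiting a periodic primitive (lemma \<open>integral_total_derivative\<close>).
\<close>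

section \<open>Smooth functions on the circle\<close>

text \<open>Smoothness cut off at a finite order, so that closure properties can be proved by induction.
  Since \<open>k = n\<close> is included, \<open>n = 0\<close> already means differentiable once.\<close>
definition ndiff :: "nat \<Rightarrow> (real \<Rightarrow> real) \<Rightarrow> bool" where
  "ndiff n f \<longleftrightarrow> (\<forall>k\<le>n. \<forall>x. (deriv ^^ k) f differentiable (at x))"

lemma ndiff_0: "ndiff 0 f \<longleftrightarrow> (\<forall>x. f differentiable (at x))"
  by (simp add: ndiff_def)

lemma ndiff_Suc: "ndiff (Suc n) f \<longleftrightarrow> (\<forall>x. f differentiable (at x)) \<and> ndiff n (deriv f)"
proof -
  have "ndiff (Suc n) f \<longleftrightarrow> (\<forall>x. f differentiable (at x)) \<and>
          (\<forall>k\<le>n. \<forall>x. (deriv ^^ Suc k) f differentiable (at x))"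
    unfolding ndiff_def using Suc_le_mono by (metis funpow_0 le0 not0_implies_Suc)
  then show ?thesis
    by (simp add: ndiff_def funpow_Suc_right del: funpow.simps)
qed

lemma ndiff_mono: "ndiff n f \<Longrightarrow> k \<le> n \<Longrightarrow> ndiff k f"
  by (auto simp: ndiff_def)

lemma ndiff_D: "ndiff n f \<Longrightarrow> f differentiable (at x)"
  by (auto simp: ndiff_def dest: spec[of _ 0])

lemma differentiable_imp_DERIV:
  fixes f :: "real \<Rightarrow> real"
  shows "f differentiable (at x) \<Longrightarrow> (f has_real_derivative deriv f x) (at x)"
  by (simp add: DERIV_deriv_iff_real_differentiable)

lemma ndiff_add: "ndiff n f \<Longrightarrow> ndiff n g \<Longrightarrow> ndiff n (\<lambda>x. f x + g x)"
proof (induction n arbitrary: f g)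
  case 0
  then show ?case by (simp add: ndiff_0)
next
  case (Suc n)
  have "deriv (\<lambda>x. f x + g x) = (\<lambda>x. deriv f x + deriv g x)"
    using Suc.prems
    by (auto intro!: ext DERIV_imp_deriv DERIV_add differentiable_imp_DERIV dest: ndiff_D)
  with Suc show ?case by (simp add: ndiff_Suc)
qed

text \<open>Leibniz' rule produces a sum of products whose factors have one derivative less to spare, so
  the induction runs over all pairs of factors at once.\<close>
lemma ndiff_mult: "ndiff n f \<Longrightarrow> ndiff n g \<Longrightarrow> ndiff n (\<lambda>x. f x * g x)"
proof (induction n arbitrary: f g)
  case 0
  then show ?case by (simp add: ndiff_0)
next
  case (Suc n)
  have "deriv (\<lambda>x. f x * g x) = (\<lambda>x. f x * deriv g x + deriv f x * g x)"
    using Suc.prems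
    by (auto intro!: ext DERIV_imp_deriv DERIV_mult' differentiable_imp_DERIV dest: ndiff_D)
  moreover have "ndiff n f" "ndiff n g"
    using Suc.prems ndiff_mono by (meson le_SucI order_refl)+
  ultimately show ?case
    using Suc by (simp add: ndiff_Suc ndiff_add)
qed

lemma ndiff_const: "ndiff n (\<lambda>_. c)"
proof (induction n arbitrary: c)
  case 0
  then show ?case by (simp add: ndiff_0)
next
  case (Suc n)
  have "deriv (\<lambda>_::real. c) = (\<lambda>_. 0)" by auto
  with Suc show ?case by (simp add: ndiff_Suc)
qed

lemma smooth_S1_iff:
  "f \<in> smooth_S1 \<longleftrightarrow> (\<forall>n. ndiff n f) \<and> (\<forall>x. f (x + 2 * pi) = f x)"
  by (auto simp: smooth_S1_def ndiff_def)

lemma smooth_S1_periodic: "f \<in> smooth_S1 \<Longrightarrow> f (x + 2 * pi) = f x"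
  by (simp add: smooth_S1_iff)

lemma smooth_S1_DERIV:
  "f \<in> smooth_S1 \<Longrightarrow> (f has_real_derivative deriv f x) (at x)"
  by (metis smooth_S1_iff ndiff_D differentiable_imp_DERIV)

lemma smooth_S1_const: "(\<lambda>_. c) \<in> smooth_S1"
  by (simp add: smooth_S1_iff ndiff_const)

lemma smooth_S1_add: "f \<in> smooth_S1 \<Longrightarrow> g \<in> smooth_S1 \<Longrightarrow> (\<lambda>x. f x + g x) \<in> smooth_S1"
  by (simp add: smooth_S1_iff ndiff_add)

lemma smooth_S1_mult: "f \<in> smooth_S1 \<Longrightarrow> g \<in> smooth_S1 \<Longrightarrow> (\<lambda>x. f x * g x) \<in> smooth_S1"
  by (simp add: smooth_S1_iff ndiff_mult)

lemma smooth_S1_diff: "f \<in> smooth_S1 \<Longrightarrow> g \<in> smooth_S1 \<Longrightarrow> (\<lambda>x. f x - g x) \<in> smooth_S1"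
  using smooth_S1_add[OF _ smooth_S1_mult[OF smooth_S1_const[of "-1"]], of f g] by simp

lemma smooth_S1_power: "f \<in> smooth_S1 \<Longrightarrow> (\<lambda>x. f x ^ n) \<in> smooth_S1"
  by (induction n) (auto intro: smooth_S1_const smooth_S1_mult)

lemma smooth_S1_divide: "f \<in> smooth_S1 \<Longrightarrow> (\<lambda>x. f x / c) \<in> smooth_S1"
  using smooth_S1_mult[OF _ smooth_S1_const[of "1 / c"], of f] by simp

lemma smooth_S1_deriv:
  assumes "f \<in> smooth_S1" shows "deriv f \<in> smooth_S1"
proof -
  have "deriv f (x + 2 * pi) = deriv f x" for x
  proof -
    have "((\<lambda>y. f (y + 2 * pi)) has_real_derivative deriv f (x + 2 * pi)) (at x)"
      using smooth_S1_DERIV[OF assms, of "x + 2 * pi"] DERIV_shift by blast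
    then show ?thesis
      using smooth_S1_periodic[OF assms] DERIV_imp_deriv by fastforce
  qed
  moreover have "ndiff n (deriv f)" for n
    using assms ndiff_Suc smooth_S1_iff by blast
  ultimately show ?thesis by (simp add: smooth_S1_iff)
qed

lemmas smooth_S1_intros =
  smooth_S1_const smooth_S1_add smooth_S1_diff smooth_S1_mult smooth_S1_power
  smooth_S1_divide smooth_S1_deriv

lemma smooth_S1_continuous: "f \<in> smooth_S1 \<Longrightarrow> continuous_on S f"
  by (meson DERIV_isCont continuous_at_imp_continuous_on smooth_S1_DERIV)

lemma smooth_S1_integrable: "f \<in> smooth_S1 \<Longrightarrow> f integrable_on {0..2 * pi}"
  by (intro integrable_continuous_interval smooth_S1_continuous)

text \<open>Integration by parts on the circle: there is no boundary term.\<close>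
lemma integral_total_derivative:
  assumes "f \<in> smooth_S1" and "\<And>x. (f has_real_derivative f' x) (at x)"
  shows "integral {0..2 * pi} f' = 0"
proof -
  have "(f' has_integral f (2 * pi) - f 0) {0..2 * pi}"
    using assms(2)
    by (intro fundamental_theorem_of_calculus)
       (auto simp: has_real_derivative_iff_has_vector_derivative[symmetric]
             intro: has_field_derivative_at_within)
  moreover have "f (2 * pi) = f 0"
    using smooth_S1_periodic[OF assms(1), of 0] by simp
  ultimately show ?thesis by (simp add: integral_unique)
qed

lemma integral_eq_if_total_derivative:
  assumes "g \<in> smooth_S1" "h \<in> smooth_S1" "f \<in> smooth_S1"
    and "\<And>x. (f has_real_derivative g x - h x) (at x)"
  shows "integral {0..2 * pi} g = integral {0..2 * pi} h"
  using integral_total_derivative[OF assms(3,4)] assms(1,2)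
  by (simp add: integral_diff smooth_S1_integrable)

lemma smooth_S1_eq_0I:
  assumes f: "f \<in> smooth_S1" and "\<And>x. x \<in> {0..2 * pi} \<Longrightarrow> f x = 0"
  shows "f = (\<lambda>_. 0)"
proof
  fix x :: real
  interpret periodic_fun_simple f "2 * pi"
    by standard (use smooth_S1_periodic[OF f] in auto)
  define n where "n = \<lfloor>x / (2 * pi)\<rfloor>"
  have "of_int n \<le> x / (2 * pi)" "x / (2 * pi) \<le> of_int n + 1"
    unfolding n_def by linarith+
  then have "x - of_int n * (2 * pi) \<in> {0..2 * pi}"
    by (simp add: field_simps)
  then have "f (x - of_int n * (2 * pi)) = 0" using assms(2) by blast
  then show "f x = 0"
    by (simp add: minus_of_int)
qed

section \<open>The pairing and gradients\<close>

lemma g_reg_iff: "(f, g) \<in> g_reg \<longleftrightarrow> f \<in> smooth_S1 \<and> g \<in> smooth_S1"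
  by (simp add: g_reg_def)

abbreviation shift :: "fpair \<Rightarrow> real \<Rightarrow> fpair \<Rightarrow> fpair" where
  "shift w s h \<equiv> (\<lambda>x. fst w x + s * fst h x, \<lambda>x. snd w x + s * snd h x)"

lemma shift_g_reg: "w \<in> g_reg \<Longrightarrow> h \<in> g_reg \<Longrightarrow> shift w s h \<in> g_reg"
  by (auto simp: g_reg_def intro!: smooth_S1_intros)

lemma pairing_commute: "pairing w z = pairing z w"
  by (simp add: pairing_def mult.commute)

lemma pairing_shift_left:
  assumes "w \<in> g_reg" "h \<in> g_reg" "z \<in> g_reg"
  shows "pairing (shift w s h) z = pairing w z + s * pairing h z"
proof -
  have wz: "(\<lambda>x. fst w x * fst z x + snd w x * snd z x) \<in> smooth_S1"
    and hz: "(\<lambda>x. fst h x * fst z x + snd h x * snd z x) \<in> smooth_S1"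
    using assms by (auto simp: g_reg_def intro!: smooth_S1_intros)
  have "pairing (shift w s h) z = integral {0..2 * pi}
      (\<lambda>x. (fst w x * fst z x + snd w x * snd z x) + s * (fst h x * fst z x + snd h x * snd z x))"
    unfolding pairing_def by (intro arg_cong[where f = "integral _"] ext) (simp add: algebra_simps)
  also have "\<dots> = pairing w z + s * pairing h z"
    unfolding pairing_def
    by (subst integral_add)
       (auto intro: smooth_S1_integrable wz smooth_S1_mult[OF smooth_S1_const hz])
  finally show ?thesis .
qed

text \<open>The pairing is positive definite on all of \<open>g_reg\<close>: continuity gives vanishing on a
  fundamental domain, periodicity the rest.\<close>
lemma pairing_self_eq_0D:
  assumes "w \<in> g_reg" "pairing w w = 0"
  shows "w = (\<lambda>_. 0, \<lambda>_. 0)"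
proof -
  obtain f g where w: "w = (f, g)" by force
  with assms have fg: "f \<in> smooth_S1" "g \<in> smooth_S1" by (auto simp: g_reg_iff)
  have cont: "continuous_on {0..2 * pi} (\<lambda>x. f x * f x + g x * g x)"
    using fg by (intro smooth_S1_continuous smooth_S1_intros)
  have "f x * f x + g x * g x = 0" if "x \<in> {0..2 * pi}" for x
    using integral_eq_0_iff[OF cont] assms(2) that unfolding w pairing_def by simp
  then have "f x = 0" "g x = 0" if "x \<in> {0..2 * pi}" for x
    using that by simp_all
  then show ?thesis
    using fg smooth_S1_eq_0I unfolding w by blast
qed

text \<open>The difference of two gradients is itself an admissible direction, on which they must agree.\<close>
lemma has_gradient_unique:
  assumes "has_gradient H w g" "has_gradient H w g'"
  shows "g = g'"
proof -
  have g: "g \<in> g_reg" "g' \<in> g_reg" using assms by (auto simp: has_gradient_def)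
  let ?d = "shift g (-1) g'"
  have d: "?d \<in> g_reg" by (rule shift_g_reg[OF g])
  have "pairing g ?d = pairing g' ?d"
    using DERIV_unique[OF assms(1)[unfolded has_gradient_def, THEN conjunct2, rule_format, OF d]
        assms(2)[unfolded has_gradient_def, THEN conjunct2, rule_format, OF d]] .
  then have "pairing ?d ?d = 0"
    using pairing_shift_left[OF g d, of "-1"] by simp
  then have "?d = (\<lambda>_. 0, \<lambda>_. 0)" by (rule pairing_self_eq_0D[OF d])
  then show ?thesis
    by (auto simp: prod_eq_iff fun_eq_iff)
qed

lemma grad_eq: "has_gradient H w g \<Longrightarrow> grad H w = g"
  unfolding grad_def by (blast intro: has_gradient_unique)

text \<open>For an integrand that is polynomial in the parameter, differentiation under the integral
  sign reduces to linearity of the integral.\<close>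
lemma DERIV_integral_cubic:
  assumes "A \<in> smooth_S1" "B \<in> smooth_S1" "C \<in> smooth_S1" "D \<in> smooth_S1"
    and "\<And>s x. f s x = A x + s * B x + s^2 * C x + s^3 * D x"
  shows "((\<lambda>s. integral {0..2 * pi} (f s)) has_real_derivative integral {0..2 * pi} B) (at 0)"
proof -
  let ?I = "integral {0..2 * pi}"
  have "?I (f s) = ?I A + s * ?I B + s^2 * ?I C + s^3 * ?I D" for s
  proof -
    have [simp]: "(\<lambda>x. c * g x) integrable_on {0..2 * pi}" if "g \<in> smooth_S1" for c :: real and g
      using that by (intro smooth_S1_integrable smooth_S1_intros)
    have "f s = (\<lambda>x. A x + s * B x + s^2 * C x + s^3 * D x)" using assms(5) by blast
    then show ?thesis
      using assms(1-4) by (simp add: integral_add integrable_add smooth_S1_integrable)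
  qed
  moreover have "((\<lambda>s. ?I A + s * ?I B + s^2 * ?I C + s^3 * ?I D) has_real_derivative ?I B) (at 0)"
    by (auto intro!: derivative_eq_intros)
  ultimately show ?thesis by simp
qed

section \<open>The inertia operator\<close>

lemma funpow_deriv: "(deriv ^^ 2) f = deriv (deriv f)" "(deriv ^^ 3) f = deriv (deriv (deriv f))"
  by (simp_all add: eval_nat_numeral)

lemma deriv_shift:
  assumes "f \<in> smooth_S1" "g \<in> smooth_S1"
  shows "deriv (\<lambda>x. f x + s * g x) = (\<lambda>x. deriv f x + s * deriv g x)"
  using assms by (intro ext DERIV_imp_deriv) (auto intro!: derivative_eq_intros smooth_S1_DERIV)

lemma M_shift:
  assumes "w \<in> g_reg" "h \<in> g_reg"
  shows "M \<alpha> \<beta> \<gamma> \<epsilon> (shift w s h) = shift (M \<alpha> \<beta> \<gamma> \<epsilon> w) s (M \<alpha> \<beta> \<gamma> \<epsilon> h)"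
  using assms
  by (cases w; cases h)
     (auto simp: g_reg_iff funpow_deriv deriv_shift smooth_S1_deriv algebra_simps)

text \<open>The off-diagonal entries of \<open>M\<close> are adjoint to each other because \<open>\<partial>\<close> is skew; the witness
  collects the boundary terms of the three integrations by parts.\<close>
lemma M_symmetric:
  assumes "w \<in> g_reg" "z \<in> g_reg"
  shows "pairing (M \<alpha> \<beta> \<gamma> \<epsilon> w) z = pairing w (M \<alpha> \<beta> \<gamma> \<epsilon> z)"
proof -
  obtain u v a b where wz: "w = (u, v)" "z = (a, b)" by force
  with assms have [intro!]: "u \<in> smooth_S1" "v \<in> smooth_S1" "a \<in> smooth_S1" "b \<in> smooth_S1"
    by (auto simp: g_reg_iff)
  show ?thesis
    unfolding pairing_def wz M.simps fst_conv snd_conv funpow_deriv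
    by (rule integral_eq_if_total_derivative
          [where f = "\<lambda>x. \<epsilon> * (u x * deriv a x - deriv u x * a x) - \<beta> * (v x * a x) + \<beta> * (u x * b x)"])
       (auto intro!: derivative_eq_intros smooth_S1_DERIV smooth_S1_intros simp: algebra_simps)
qed

text \<open>Differentiation passes through the constant coefficients of \<open>M\<close>. This is what makes the
  second Hamiltonian form computable without a formula for \<open>M\<^sup>-\<^sup>1\<close>.\<close>
lemma J1_eq_deriv_M:
  assumes "z \<in> g_reg"
  shows "J1 \<alpha> \<beta> \<gamma> \<epsilon> z = (deriv (fst (M \<alpha> \<beta> \<gamma> \<epsilon> z)), deriv (snd (M \<alpha> \<beta> \<gamma> \<epsilon> z)))"
proof -
  obtain f g where z: "z = (f, g)" by force
  with assms have [intro!]: "f \<in> smooth_S1" "g \<in> smooth_S1" by (auto simp: g_reg_iff)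
  show ?thesis
    unfolding z J1.simps M.simps fst_conv snd_conv funpow_deriv
    by (auto intro!: ext DERIV_imp_deriv[symmetric] derivative_eq_intros smooth_S1_DERIV
        smooth_S1_deriv simp: algebra_simps)
qed

lemma J0_g_reg: "w \<in> g_reg \<Longrightarrow> z \<in> g_reg \<Longrightarrow> J0 w z \<in> g_reg"
  by (cases w; cases z) (auto simp: g_reg_iff intro!: smooth_S1_intros)

context
  fixes \<alpha> \<beta> \<gamma> \<epsilon> :: real
  assumes bij: "invertible_op (M \<alpha> \<beta> \<gamma> \<epsilon>)"
begin

lemma M_inv_g_reg: "w \<in> g_reg \<Longrightarrow> M_inv \<alpha> \<beta> \<gamma> \<epsilon> w \<in> g_reg"
  using bij unfolding invertible_op_def M_inv_def by (metis bij_betw_def inv_into_into)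

lemma M_M_inv: "w \<in> g_reg \<Longrightarrow> M \<alpha> \<beta> \<gamma> \<epsilon> (M_inv \<alpha> \<beta> \<gamma> \<epsilon> w) = w"
  using bij unfolding invertible_op_def M_inv_def by (metis bij_betw_inv_into_right)

lemma M_inv_M: "z \<in> g_reg \<Longrightarrow> M_inv \<alpha> \<beta> \<gamma> \<epsilon> (M \<alpha> \<beta> \<gamma> \<epsilon> z) = z"
  using bij unfolding invertible_op_def M_inv_def by (metis bij_betw_inv_into_left)

lemma M_inv_shift:
  assumes "w \<in> g_reg" "h \<in> g_reg"
  shows "M_inv \<alpha> \<beta> \<gamma> \<epsilon> (shift w s h) = shift (M_inv \<alpha> \<beta> \<gamma> \<epsilon> w) s (M_inv \<alpha> \<beta> \<gamma> \<epsilon> h)"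
  using M_shift[OF assms[THEN M_inv_g_reg], of \<alpha> \<beta> \<gamma> \<epsilon> s]
    M_inv_M[OF shift_g_reg[OF assms[THEN M_inv_g_reg]], of s] M_M_inv assms
  by simp

lemma M_inv_symmetric:
  assumes "w \<in> g_reg" "z \<in> g_reg"
  shows "pairing (M_inv \<alpha> \<beta> \<gamma> \<epsilon> w) z = pairing w (M_inv \<alpha> \<beta> \<gamma> \<epsilon> z)"
  using M_symmetric[OF assms[THEN M_inv_g_reg], of \<alpha> \<beta> \<gamma> \<epsilon>] assms by (simp add: M_M_inv)

section \<open>The Hamiltonians\<close>

lemma has_gradient_H0:
  assumes w: "w \<in> g_reg"
  shows "has_gradient (H0 \<alpha> \<beta> \<gamma> \<epsilon>) w (M_inv \<alpha> \<beta> \<gamma> \<epsilon> w)"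
  unfolding has_gradient_def
proof (intro conjI ballI)
  show "M_inv \<alpha> \<beta> \<gamma> \<epsilon> w \<in> g_reg" by (rule M_inv_g_reg[OF w])
  fix h assume h: "h \<in> g_reg"
  let ?w = "M_inv \<alpha> \<beta> \<gamma> \<epsilon> w" and ?h = "M_inv \<alpha> \<beta> \<gamma> \<epsilon> h"
  note reg = w h w[THEN M_inv_g_reg] h[THEN M_inv_g_reg]
  have "H0 \<alpha> \<beta> \<gamma> \<epsilon> (shift w s h) =
      1 / 2 * pairing w ?w + s * pairing ?w h + s^2 * (1 / 2 * pairing h ?h)" for s
  proof -
    have *: "pairing z (shift ?w s ?h) = pairing z ?w + s * pairing z ?h" if "z \<in> g_reg" for z
      using pairing_shift_left[OF reg(3,4) that] by (simp add: pairing_commute)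
    have "H0 \<alpha> \<beta> \<gamma> \<epsilon> (shift w s h) = 1 / 2 * pairing (shift w s h) (shift ?w s ?h)"
      by (simp only: H0_def M_inv_shift[OF w h])
    also have "\<dots> = 1 / 2 * (pairing w (shift ?w s ?h) + s * pairing h (shift ?w s ?h))"
      by (simp only: pairing_shift_left[OF w h shift_g_reg[OF reg(3,4)]])
    also have "\<dots> = 1 / 2 * (pairing w ?w + s * pairing ?w h + s * (pairing ?w h + s * pairing h ?h))"
      by (simp only: *[OF w] *[OF h] M_inv_symmetric[OF w h] pairing_commute[of h ?w])
    finally show ?thesis by (simp add: algebra_simps power2_eq_square)
  qed
  then show "((\<lambda>s. H0 \<alpha> \<beta> \<gamma> \<epsilon> (shift w s h)) has_real_derivative pairing ?w h) (at 0)"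
    by (auto intro!: derivative_eq_intros)
qed

end

text \<open>The variational derivative \<open>(\<delta>F/\<delta>u, \<delta>F/\<delta>v)\<close> of the cubic functional \<open>F\<close> for which
  \<open>H1 w = F (M_inv w)\<close>.\<close>
fun cubic_grad :: "real \<Rightarrow> real \<Rightarrow> real \<Rightarrow> real \<Rightarrow> fpair \<Rightarrow> fpair" where
  "cubic_grad \<alpha> \<beta> \<gamma> \<epsilon> (u, v) =
     (\<lambda>x. 2 * \<alpha> * u x * v x - \<beta> * u x * deriv v x + \<gamma> / 2 * (v x)^2 + 3 / 2 * \<epsilon> * (u x)^2
            - \<epsilon> / 2 * (deriv u x)^2 - \<epsilon> * u x * deriv (deriv u) x,
      \<lambda>x. \<alpha> * (u x)^2 + \<beta> * u x * deriv u x + \<gamma> * u x * v x)"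

lemma cubic_grad_g_reg: "z \<in> g_reg \<Longrightarrow> cubic_grad \<alpha> \<beta> \<gamma> \<epsilon> z \<in> g_reg"
  by (cases z) (auto simp: g_reg_iff intro!: smooth_S1_intros)

text \<open>In the second component both sides are \<open>\<partial>(p u)\<close>, as \<open>\<delta>F/\<delta>v = p u\<close>. The first component of
  \<open>J0\<close> is not visibly a derivative; it becomes one only after \<open>m\<close> and \<open>p\<close> are expressed
  through \<open>u\<close> and \<open>v\<close>.\<close>
lemma J0_M_eq_derivative:
  assumes "z \<in> g_reg"
  shows "J0 (M \<alpha> \<beta> \<gamma> \<epsilon> z) z =
    (deriv (fst (cubic_grad \<alpha> \<beta> \<gamma> \<epsilon> z)), deriv (snd (cubic_grad \<alpha> \<beta> \<gamma> \<epsilon> z)))"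
proof -
  obtain u v where z: "z = (u, v)" by force
  with assms have uv [intro!]: "u \<in> smooth_S1" "v \<in> smooth_S1" by (auto simp: g_reg_iff)
  have m: "deriv (\<lambda>x. \<epsilon> * (u x - deriv (deriv u) x) + (\<alpha> * v x - \<beta> * deriv v x)) x =
      \<epsilon> * (deriv u x - deriv (deriv (deriv u)) x) + (\<alpha> * deriv v x - \<beta> * deriv (deriv v) x)"
    and p: "deriv (\<lambda>x. (\<alpha> * u x + \<beta> * deriv u x) + \<gamma> * v x) x =
      (\<alpha> * deriv u x + \<beta> * deriv (deriv u) x) + \<gamma> * deriv v x" for x
    by (auto intro!: DERIV_imp_deriv derivative_eq_intros smooth_S1_DERIV smooth_S1_deriv)
  show ?thesis
    unfolding z J0.simps M.simps cubic_grad.simps fst_conv snd_conv funpow_deriv m p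
    by (auto intro!: ext DERIV_imp_deriv[symmetric] derivative_eq_intros smooth_S1_DERIV
        smooth_S1_deriv simp: algebra_simps power2_eq_square)
qed

lemma DERIV_cubic_functional:
  fixes \<alpha> \<beta> \<gamma> \<epsilon> :: real
  assumes "z \<in> g_reg" "h \<in> g_reg"
  defines "F \<equiv> \<lambda>(u, v). integral {0..2 * pi} (\<lambda>x.
       2 * \<alpha> * (u x)^2 * v x + 2 * \<beta> * u x * deriv u x * v x + \<gamma> * u x * (v x)^2
       + \<epsilon> * (u x)^3 + \<epsilon> * u x * (deriv u x)^2)"
  shows "((\<lambda>s. 1 / 2 * F (shift z s h)) has_real_derivative
    pairing (cubic_grad \<alpha> \<beta> \<gamma> \<epsilon> z) h) (at 0)"
proof -
  obtain u v a b where zh: "z = (u, v)" "h = (a, b)" by force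
  with assms have uv [intro!]: "u \<in> smooth_S1" "v \<in> smooth_S1" "a \<in> smooth_S1" "b \<in> smooth_S1"
    by (auto simp: g_reg_iff)
  \<comment> \<open>\<open>B\<close> is the coefficient of \<open>s\<close> in the integrand of \<open>F (shift z s h)\<close>.\<close>
  define B where "B = (\<lambda>x. 2 * \<alpha> * (2 * u x * a x * v x + (u x)^2 * b x)
    + 2 * \<beta> * (a x * deriv u x * v x + u x * deriv a x * v x + u x * deriv u x * b x)
    + \<gamma> * (a x * (v x)^2 + 2 * u x * v x * b x) + 3 * \<epsilon> * (u x)^2 * a x
    + \<epsilon> * (a x * (deriv u x)^2 + 2 * u x * deriv u x * deriv a x))"
  have B: "B \<in> smooth_S1" unfolding B_def by (intro smooth_S1_intros uv)
  have shift: "F (shift z s h) = integral {0..2 * pi} (\<lambda>x.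
       2 * \<alpha> * (u x + s * a x)^2 * (v x + s * b x)
       + 2 * \<beta> * (u x + s * a x) * (deriv u x + s * deriv a x) * (v x + s * b x)
       + \<gamma> * (u x + s * a x) * (v x + s * b x)^2 + \<epsilon> * (u x + s * a x)^3
       + \<epsilon> * (u x + s * a x) * (deriv u x + s * deriv a x)^2)" for s
    unfolding F_def zh by (simp add: deriv_shift uv)
  have "((\<lambda>s. F (shift z s h)) has_real_derivative integral {0..2 * pi} B) (at 0)"
    unfolding shift
  proof (rule DERIV_integral_cubic[where B = B and
        A = "\<lambda>x. 2 * \<alpha> * (u x)^2 * v x + 2 * \<beta> * u x * deriv u x * v x + \<gamma> * u x * (v x)^2
              + \<epsilon> * (u x)^3 + \<epsilon> * u x * (deriv u x)^2" and
        C = "\<lambda>x. 2 * \<alpha> * ((a x)^2 * v x + 2 * u x * a x * b x)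
              + 2 * \<beta> * (a x * deriv a x * v x + a x * deriv u x * b x + u x * deriv a x * b x)
              + \<gamma> * (2 * a x * v x * b x + u x * (b x)^2) + 3 * \<epsilon> * u x * (a x)^2
              + \<epsilon> * (2 * a x * deriv u x * deriv a x + u x * (deriv a x)^2)" and
        D = "\<lambda>x. 2 * \<alpha> * (a x)^2 * b x + 2 * \<beta> * a x * deriv a x * b x + \<gamma> * a x * (b x)^2
              + \<epsilon> * (a x)^3 + \<epsilon> * a x * (deriv a x)^2"])
  qed (intro B smooth_S1_intros uv | unfold B_def, algebra)+
  then have "((\<lambda>s. 1 / 2 * F (shift z s h)) has_real_derivative 1 / 2 * integral {0..2 * pi} B) (at 0)"
    by (rule DERIV_cmult)
  moreover have "1 / 2 * integral {0..2 * pi} B = integral {0..2 * pi} (\<lambda>x. 1 / 2 * B x)"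
    by simp
  \<comment> \<open>The pairing with \<open>h\<close> admits no derivative of \<open>a\<close>; the two terms of \<open>B\<close> with
    \<open>deriv a\<close> are integrated by parts.\<close>
  moreover have "\<dots> = pairing (cubic_grad \<alpha> \<beta> \<gamma> \<epsilon> z) h"
    unfolding pairing_def zh cubic_grad.simps fst_conv snd_conv B_def
    by (rule integral_eq_if_total_derivative
          [where f = "\<lambda>x. \<beta> * (u x * v x * a x) + \<epsilon> * (u x * deriv u x * a x)"])
       (auto intro!: derivative_eq_intros smooth_S1_DERIV smooth_S1_intros
          simp: field_simps power2_eq_square)
  ultimately show ?thesis by simp
qed

text \<open>The chain rule: \<open>M_inv\<close> is linear, so it maps a line to a line, and its symmetry moves it from
  the direction onto the variational derivative.\<close>
lemma has_gradient_H1: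
  assumes bij: "invertible_op (M \<alpha> \<beta> \<gamma> \<epsilon>)" and w: "w \<in> g_reg"
  shows "has_gradient (H1 \<alpha> \<beta> \<gamma> \<epsilon>) w
    (M_inv \<alpha> \<beta> \<gamma> \<epsilon> (cubic_grad \<alpha> \<beta> \<gamma> \<epsilon> (M_inv \<alpha> \<beta> \<gamma> \<epsilon> w)))"
  unfolding has_gradient_def
proof (intro conjI ballI)
  let ?w = "M_inv \<alpha> \<beta> \<gamma> \<epsilon> w"
  have reg: "?w \<in> g_reg" "cubic_grad \<alpha> \<beta> \<gamma> \<epsilon> ?w \<in> g_reg"
    using w by (simp_all add: M_inv_g_reg[OF bij] cubic_grad_g_reg)
  show "M_inv \<alpha> \<beta> \<gamma> \<epsilon> (cubic_grad \<alpha> \<beta> \<gamma> \<epsilon> ?w) \<in> g_reg"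
    by (rule M_inv_g_reg[OF bij reg(2)])
  fix h assume h: "h \<in> g_reg"
  show "((\<lambda>s. H1 \<alpha> \<beta> \<gamma> \<epsilon> (shift w s h)) has_real_derivative
      pairing (M_inv \<alpha> \<beta> \<gamma> \<epsilon> (cubic_grad \<alpha> \<beta> \<gamma> \<epsilon> ?w)) h) (at 0)"
    using DERIV_cubic_functional[OF reg(1) M_inv_g_reg[OF bij h], of \<alpha> \<beta> \<gamma> \<epsilon>]
    unfolding H1_def M_inv_shift[OF bij w h] M_inv_symmetric[OF bij reg(2) h]
    by (simp only: prod.case)
qed

section \<open>The bihamiltonian identity and the evolution equation\<close>

theorem mainTheorem2:
  fixes \<alpha> \<beta> \<gamma> \<epsilon> :: real
  assumes "strictly_positive (M \<alpha> \<beta> \<gamma> \<epsilon>)"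
    and "invertible_op (M \<alpha> \<beta> \<gamma> \<epsilon>)"
  shows
    "(\<forall>m p u v. (m, p) \<in> g_reg \<and> (u, v) = M_inv \<alpha> \<beta> \<gamma> \<epsilon> (m, p) \<longrightarrow>
        (u, v) \<in> g_reg \<and>
        m = (\<lambda>x. \<epsilon> * u x - \<epsilon> * (deriv ^^ 2) u x + \<alpha> * v x - \<beta> * deriv v x) \<and>
        p = (\<lambda>x. \<alpha> * u x + \<beta> * deriv u x + \<gamma> * v x)) \<and>
     (\<forall>w\<in>g_reg.
        has_gradient (H0 \<alpha> \<beta> \<gamma> \<epsilon>) w (grad (H0 \<alpha> \<beta> \<gamma> \<epsilon>) w) \<and>
        has_gradient (H1 \<alpha> \<beta> \<gamma> \<epsilon>) w (grad (H1 \<alpha> \<beta> \<gamma> \<epsilon>) w) \<and>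
        X \<alpha> \<beta> \<gamma> \<epsilon> w \<in> g_reg \<and>
        X \<alpha> \<beta> \<gamma> \<epsilon> w = J0 w (grad (H0 \<alpha> \<beta> \<gamma> \<epsilon>) w) \<and>
        X \<alpha> \<beta> \<gamma> \<epsilon> w = J1 \<alpha> \<beta> \<gamma> \<epsilon> (grad (H1 \<alpha> \<beta> \<gamma> \<epsilon>) w)) \<and>
     (\<forall>T m p u v. open T \<and> reg_curve T m p \<and>
        (\<forall>t\<in>T. (u t, v t) = M_inv \<alpha> \<beta> \<gamma> \<epsilon> (m t, p t)) \<longrightarrow>
        (evolution_eq (X \<alpha> \<beta> \<gamma> \<epsilon>) T m p \<longleftrightarrow>
         (\<forall>t\<in>T. \<forall>x.
            deriv (\<lambda>s. m s x) t + deriv (m t) x * u t x + 2 * m t x * deriv (u t) x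
              + p t x * deriv (v t) x = 0 \<and>
            deriv (\<lambda>s. p s x) t + deriv (\<lambda>y. p t y * u t y) x = 0)))"
proof -
  note bij = assms(2)
  let ?Mi = "M_inv \<alpha> \<beta> \<gamma> \<epsilon>" and ?G = "cubic_grad \<alpha> \<beta> \<gamma> \<epsilon>"
  have X: "X \<alpha> \<beta> \<gamma> \<epsilon> w = J0 w (?Mi w)" if "w \<in> g_reg" for w
    unfolding X_def grad_eq[OF has_gradient_H0[OF bij that]] ..
  have inv: "(u, v) \<in> g_reg \<and>
        m = (\<lambda>x. \<epsilon> * u x - \<epsilon> * (deriv ^^ 2) u x + \<alpha> * v x - \<beta> * deriv v x) \<and>
        p = (\<lambda>x. \<alpha> * u x + \<beta> * deriv u x + \<gamma> * v x)"
    if "(m, p) \<in> g_reg" "(u, v) = ?Mi (m, p)" for m p u v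
    using M_inv_g_reg[OF bij that(1)] M_M_inv[OF bij that(1)]
    unfolding that(2)[symmetric] by (auto simp: algebra_simps)
  have bihamiltonian: "X \<alpha> \<beta> \<gamma> \<epsilon> w = J1 \<alpha> \<beta> \<gamma> \<epsilon> (grad (H1 \<alpha> \<beta> \<gamma> \<epsilon>) w)" if w: "w \<in> g_reg" for w
  proof -
    have reg: "?Mi w \<in> g_reg" "?G (?Mi w) \<in> g_reg"
      using w by (simp_all add: M_inv_g_reg[OF bij] cubic_grad_g_reg)
    have "J1 \<alpha> \<beta> \<gamma> \<epsilon> (grad (H1 \<alpha> \<beta> \<gamma> \<epsilon>) w) = J1 \<alpha> \<beta> \<gamma> \<epsilon> (?Mi (?G (?Mi w)))"
      unfolding grad_eq[OF has_gradient_H1[OF bij w]] ..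
    also have "\<dots> = (deriv (fst (?G (?Mi w))), deriv (snd (?G (?Mi w))))"
      unfolding J1_eq_deriv_M[OF M_inv_g_reg[OF bij reg(2)]] M_M_inv[OF bij reg(2)] ..
    also have "\<dots> = J0 w (?Mi w)"
      using J0_M_eq_derivative[OF reg(1), of \<alpha> \<beta> \<gamma> \<epsilon>] unfolding M_M_inv[OF bij w] by simp
    finally show ?thesis using X[OF w] by simp
  qed
  have evolution: "evolution_eq (X \<alpha> \<beta> \<gamma> \<epsilon>) T m p \<longleftrightarrow>
         (\<forall>t\<in>T. \<forall>x.
            deriv (\<lambda>s. m s x) t + deriv (m t) x * u t x + 2 * m t x * deriv (u t) x
              + p t x * deriv (v t) x = 0 \<and>
            deriv (\<lambda>s. p s x) t + deriv (\<lambda>y. p t y * u t y) x = 0)"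
    if curve: "reg_curve T m p" and uv: "\<forall>t\<in>T. (u t, v t) = ?Mi (m t, p t)" for T m p u v
  proof -
    have "fst (X \<alpha> \<beta> \<gamma> \<epsilon> (m t, p t)) x =
          deriv (m t) x * u t x + 2 * m t x * deriv (u t) x + p t x * deriv (v t) x"
      and "snd (X \<alpha> \<beta> \<gamma> \<epsilon> (m t, p t)) x = deriv (\<lambda>y. p t y * u t y) x" if t: "t \<in> T" for t x
    proof -
      have mp: "(m t, p t) \<in> g_reg" using curve t by (simp add: reg_curve_def)
      have eq: "(u t, v t) = ?Mi (m t, p t)" using uv t by blast
      have Xt: "X \<alpha> \<beta> \<gamma> \<epsilon> (m t, p t) = J0 (m t, p t) (u t, v t)"
        using X[OF mp] eq by simp
      have "u t \<in> smooth_S1" "p t \<in> smooth_S1"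
        using mp inv[OF mp eq] by (auto simp: g_reg_iff)
      then have "deriv (\<lambda>y. p t y * u t y) x = deriv (p t) x * u t x + p t x * deriv (u t) x"
        by (auto intro!: DERIV_imp_deriv derivative_eq_intros smooth_S1_DERIV)
      then show "fst (X \<alpha> \<beta> \<gamma> \<epsilon> (m t, p t)) x =
          deriv (m t) x * u t x + 2 * m t x * deriv (u t) x + p t x * deriv (v t) x"
        and "snd (X \<alpha> \<beta> \<gamma> \<epsilon> (m t, p t)) x = deriv (\<lambda>y. p t y * u t y) x"
        by (simp_all add: Xt)
    qed
    then show ?thesis
      unfolding evolution_eq_def by (simp add: add.assoc)
  qed
  show ?thesis
  proof (intro conjI ballI)
    fix w assume w: "w \<in> g_reg"
    show "has_gradient (H0 \<alpha> \<beta> \<gamma> \<epsilon>) w (grad (H0 \<alpha> \<beta> \<gamma> \<epsilon>) w)"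
      using has_gradient_H0[OF bij w] grad_eq by metis
    show "has_gradient (H1 \<alpha> \<beta> \<gamma> \<epsilon>) w (grad (H1 \<alpha> \<beta> \<gamma> \<epsilon>) w)"
      using has_gradient_H1[OF bij w] grad_eq by metis
    show "X \<alpha> \<beta> \<gamma> \<epsilon> w \<in> g_reg"
      using X[OF w] J0_g_reg[OF w M_inv_g_reg[OF bij w]] by simp
    show "X \<alpha> \<beta> \<gamma> \<epsilon> w = J0 w (grad (H0 \<alpha> \<beta> \<gamma> \<epsilon>) w)"
      by (rule X_def)
    show "X \<alpha> \<beta> \<gamma> \<epsilon> w = J1 \<alpha> \<beta> \<gamma> \<epsilon> (grad (H1 \<alpha> \<beta> \<gamma> \<epsilon>) w)"
      by (rule bihamiltonian[OF w])
  qed (use inv evolution in blast)+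
qed

end
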